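(* Let $\{S_i\}_{i=1}^m$ be an SS-IFS in $\mathbb{R}^d$ with attractor $K\subseteq\mathbb{R}^d$ containing at least two points, and let $s$ be its similarity dimension. Assume that the transformation group $\mathcal{T}$ of the SS-IFS is finite and let $l\in\mathbb{N}$, $l<d$. Then there exists an $l$-dimensional linear subspace $M\subseteq\mathbb{R}^d$ such that $\dim_H(\Pi_M(K))<s$.
   Context: $\dim_H$ denotes Hausdorff dimension and $\Pi_M:\mathbb{R}^d\to M$ is orthogonal projection onto $M$. A self-similar iterated function system (SS-IFS) in $\mathbb{R}^d$ is a finite collection $\{S_i\}_{i=1}^m$ of contracting similarities of $\mathbb{R}^d$, written uniquely as $S_i(x)=r_iT_i(x)+v_i$ with $0<r_i<1$, $T_i$ an orthogonal transformation of $\mathbb{R}^d$ and $v_i\in\mathbb{R}^d$. Its attractor is the unique nonempty compact $K$ with $K=\bigcup_{i=1}^m S_i(K)$. Its similarity dimension is the unique $s$ with $\sum_{i=1}^m r_i^s=1$. Its transformation group $\mathcal{T}$ is the group generated by $T_1,\ldots,T_m$. *)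

theory Defs
  imports
    "HOL-Analysis.Analysis"
    "HOL-Algebra.Bij"
    "HOL-Algebra.Generated_Groups"
begin

section \<open>Hausdorff measure and Hausdorff dimension\<close>

text \<open>
  The convention for exponent 0 is that a nonempty set contributes 1, also when it is a single
  point (so that the 0-dimensional measure is the counting measure); the library has
  \<^prop>\<open>(0::real) powr 0 = 0\<close>, so this has to be spelled out. The empty set contributes 0.
\<close>

definition diameter_pow :: "real \<Rightarrow> 'a::metric_space set \<Rightarrow> real" where
  "diameter_pow t U = (if U = {} then 0 else if t = 0 then 1 else diameter U powr t)"

text \<open>
  Coverings are countable; finite ones are padded with the empty set. Boundedness is required
  because \<^const>\<open>diameter\<close> is real-valued and unspecified on unbounded sets.
\<close>

definition delta_cover :: "real \<Rightarrow> 'a::metric_space set \<Rightarrow> (nat \<Rightarrow> 'a set) \<Rightarrow> bool" where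
  "delta_cover \<delta> A U \<longleftrightarrow> A \<subseteq> (\<Union>n. U n) \<and> (\<forall>n. bounded (U n) \<and> diameter (U n) \<le> \<delta>)"

definition hausdorff_premeasure :: "real \<Rightarrow> real \<Rightarrow> 'a::metric_space set \<Rightarrow> ennreal" where
  "hausdorff_premeasure t \<delta> A =
     (INF U \<in> {U. delta_cover \<delta> A U}. \<Sum>n. ennreal (diameter_pow t (U n)))"

definition hausdorff_measure :: "real \<Rightarrow> 'a::metric_space set \<Rightarrow> ennreal" where
  "hausdorff_measure t A = (SUP \<delta> \<in> {0<..}. hausdorff_premeasure t \<delta> A)"

definition hausdorff_dim :: "'a::metric_space set \<Rightarrow> ereal" where
  "hausdorff_dim A = Inf {ereal t |t. 0 \<le> t \<and> hausdorff_measure t A = 0}"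


section \<open>Orthogonal projection\<close>

definition orthogonal_projection :: "'a::euclidean_space set \<Rightarrow> 'a \<Rightarrow> 'a" where
  "orthogonal_projection M x = (THE y. y \<in> M \<and> (\<forall>w\<in>M. orthogonal (x - y) w))"

lemma orthogonal_projection_ex1:
  fixes M :: "'a::euclidean_space set"
  assumes "subspace M"
  shows "\<exists>!y. y \<in> M \<and> (\<forall>w\<in>M. orthogonal (x - y) w)"
proof -
  have sp: "span M = M"
    using assms by (simp add: span_eq_iff)
  obtain y z where y: "y \<in> M" and z: "\<And>w. w \<in> M \<Longrightarrow> orthogonal z w" and x: "x = y + z"
    using orthogonal_subspace_decomp_exists[of M x] sp by metis
  show ?thesis
  proof (rule ex1I[of _ y])
    show "y \<in> M \<and> (\<forall>w\<in>M. orthogonal (x - y) w)"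
      using y z x by simp
  next
    fix y' assume y': "y' \<in> M \<and> (\<forall>w\<in>M. orthogonal (x - y') w)"
    have d: "y' - y \<in> M"
      using assms y y' by (simp add: subspace_diff)
    have "(y' - y) \<bullet> (y' - y) = (x - y) \<bullet> (y' - y) - (x - y') \<bullet> (y' - y)"
      by (simp add: inner_diff_left)
    also have "\<dots> = 0"
      using z[OF d] y' d x by (simp add: orthogonal_def)
    finally show "y' = y" by simp
  qed
qed


section \<open>Self-similar iterated function systems\<close>

text \<open>
  The maps of the system are indexed by \<open>{..<m}\<close>, and \<open>r\<close>, \<open>T\<close>, \<open>v\<close> are the (uniquely determined)
  contraction ratios, orthogonal parts and translation vectors.
\<close>

definition ss_ifs ::
  "nat \<Rightarrow> (nat \<Rightarrow> 'a::euclidean_space \<Rightarrow> 'a) \<Rightarrow> (nat \<Rightarrow> real) \<Rightarrow> (nat \<Rightarrow> 'a \<Rightarrow> 'a) \<Rightarrow> (nat \<Rightarrow> 'a) \<Rightarrow> bool"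
where
  "ss_ifs m S r T v \<longleftrightarrow>
     (\<forall>i<m. 0 < r i \<and> r i < 1 \<and> orthogonal_transformation (T i) \<and>
            (\<forall>x. S i x = r i *\<^sub>R T i x + v i))"

definition is_attractor ::
  "nat \<Rightarrow> (nat \<Rightarrow> 'a::euclidean_space \<Rightarrow> 'a) \<Rightarrow> 'a set \<Rightarrow> bool" where
  "is_attractor m S K \<longleftrightarrow> compact K \<and> K \<noteq> {} \<and> K = (\<Union>i<m. S i ` K)"

definition is_similarity_dim :: "nat \<Rightarrow> (nat \<Rightarrow> real) \<Rightarrow> real \<Rightarrow> bool" where
  "is_similarity_dim m r s \<longleftrightarrow> (\<Sum>i<m. r i powr s) = 1"

lemma is_similarity_dim_ex1:
  assumes m: "m > 0" and r: "\<And>i. i < m \<Longrightarrow> 0 < r i \<and> r i < 1"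
  shows "\<exists>!s. is_similarity_dim m r s"
proof -
  define f where "f s = (\<Sum>i<m. r i powr s)" for s
  have dec: "f t < f s" if "s < t" for s t
    unfolding f_def
  proof (rule sum_strict_mono)
    show "r i powr t < r i powr s" if "i \<in> {..<m}" for i
      using r[of i] that \<open>s < t\<close> by (simp add: powr_less_mono')
  qed (use m in auto)
  have cont: "continuous_on UNIV f"
    unfolding f_def by (intro continuous_intros) (use r in force)
  have f0: "f 0 \<ge> 1"
  proof -
    have "f 0 = (\<Sum>i<m. 1)"
      unfolding f_def by (rule sum.cong) (use r in force)+
    then show ?thesis using m by simp
  qed
  have "(f \<longlongrightarrow> (\<Sum>i<m. 0)) at_top"
    unfolding f_def
  proof (rule tendsto_sum)
    fix i assume "i \<in> {..<m}"
    then have ri: "0 < r i" "r i < 1" using r by auto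
    have "filterlim (\<lambda>s. ln (r i) * s) at_bot at_top"
      using ri by (intro filterlim_tendsto_neg_mult_at_bot[OF tendsto_const] filterlim_ident) simp
    then have "((\<lambda>s. exp (ln (r i) * s)) \<longlongrightarrow> 0) at_top"
      by (rule filterlim_compose[OF exp_at_bot])
    then show "((\<lambda>s. r i powr s) \<longlongrightarrow> 0) at_top"
      using ri by (simp add: powr_def mult.commute)
  qed
  then have "\<forall>\<^sub>F s in at_top. f s < 1"
    by (intro order_tendstoD(2)) auto
  then obtain b where b: "\<And>s. s \<ge> b \<Longrightarrow> f s < 1"
    by (auto simp: eventually_at_top_linorder)
  have "\<exists>s\<ge>0. s \<le> max 0 b \<and> f s = 1"
    by (rule IVT2') (use b[of "max 0 b"] f0 cont in \<open>auto intro: continuous_on_subset\<close>)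
  then obtain s where s: "f s = 1" by blast
  show ?thesis
  proof (rule ex1I[of _ s])
    show "is_similarity_dim m r s" using s by (simp add: is_similarity_dim_def f_def)
  next
    fix t assume "is_similarity_dim m r t"
    then have "f t = 1" by (simp add: is_similarity_dim_def f_def)
    then show "t = s" using s dec[of s t] dec[of t s] by linarith
  qed
qed

text \<open>The ambient group is the group of all bijections of the space, under composition.\<close>

definition transformation_group :: "nat \<Rightarrow> (nat \<Rightarrow> 'a \<Rightarrow> 'a) \<Rightarrow> ('a \<Rightarrow> 'a) set" where
  "transformation_group m T = generate (BijGroup UNIV) (T ` {..<m})"

lemma orthogonal_transformation_in_BijGroup:
  fixes f :: "'a::euclidean_space \<Rightarrow> 'a"
  assumes "orthogonal_transformation f"
  shows "f \<in> carrier (BijGroup UNIV)"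
  using orthogonal_transformation_bij[OF assms]
  by (simp add: BijGroup_def Bij_def)

end

theory Submission
  imports Defs
begin

text \<open>
  Since the group is finite, the linear parts of words form a finite semigroup in which every
  element has an inverse. In particular there are words \<open>a\<close> and \<open>b\<close>, powers of two different letters,
  whose maps are homotheties; then \<open>ab\<close> and \<open>ba\<close> give maps that differ only by a constant vector
  \<open>w\<close>. Choose \<open>M\<close> orthogonal to \<open>w\<close>. For every linear part \<open>g\<close> of a word there is a word \<open>u\<close> such
  that \<open>g\<close> composed with the linear part of \<open>u\<close> is the identity, so the pieces of the projection of
  \<open>g K\<close> that belong to \<open>uab\<close> and \<open>uba\<close> coincide and one of them can be dropped. Hence the finitely
  many projections of the sets \<open>g K\<close> form a graph-directed system in which the sums of the \<open>s\<close>-th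
  powers of the ratios are all less than 1, and this persists for some exponent \<open>t < s\<close>.
\<close>

section \<open>Finite covers\<close>

text \<open>No bound on the single diameters is imposed: for \<open>0 < t\<close> a small sum
  already forces every covering set to be small. With lists, uniting covers is
  concatenation.\<close>

definition finite_cover_sum :: "real \<Rightarrow> real \<Rightarrow> 'a::metric_space set \<Rightarrow> bool" where
  "finite_cover_sum t \<epsilon> A \<longleftrightarrow>
     (\<exists>Us. A \<subseteq> \<Union>(set Us) \<and> (\<forall>U\<in>set Us. bounded U) \<and> (\<Sum>U\<leftarrow>Us. diameter U powr t) \<le> \<epsilon>)"

lemma finite_cover_sum_mono:
  "finite_cover_sum t \<epsilon> A \<Longrightarrow> B \<subseteq> A \<Longrightarrow> \<epsilon> \<le> \<epsilon>' \<Longrightarrow> finite_cover_sum t \<epsilon>' B"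
  unfolding finite_cover_sum_def by (meson order_trans)

lemma finite_cover_sum_self:
  "bounded A \<Longrightarrow> finite_cover_sum t (diameter A powr t) A"
  unfolding finite_cover_sum_def by (intro exI[of _ "[A]"]) simp

lemma finite_cover_sum_UN:
  assumes "finite I" "\<And>i. i \<in> I \<Longrightarrow> finite_cover_sum t (e i) (A i)"
  shows "finite_cover_sum t (\<Sum>i\<in>I. e i) (\<Union>i\<in>I. A i)"
  using assms
proof (induction I rule: finite_induct)
  case empty
  show ?case unfolding finite_cover_sum_def by (intro exI[of _ "[]"]) simp
next
  case (insert i I)
  then obtain Us Vs where
    "A i \<subseteq> \<Union>(set Us)" "\<forall>U\<in>set Us. bounded U" "(\<Sum>U\<leftarrow>Us. diameter U powr t) \<le> e i"
    "(\<Union>i\<in>I. A i) \<subseteq> \<Union>(set Vs)" "\<forall>U\<in>set Vs. bounded U"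
    "(\<Sum>U\<leftarrow>Vs. diameter U powr t) \<le> (\<Sum>i\<in>I. e i)"
    unfolding finite_cover_sum_def by (metis insertI1 insertI2)
  then show ?case
    unfolding finite_cover_sum_def using insert.hyps
    by (intro exI[of _ "Us @ Vs"]) (auto intro: add_mono)
qed

lemma diameter_lipschitz_image_le:
  fixes f :: "'a::metric_space \<Rightarrow> 'b::metric_space"
  assumes "\<And>x y. dist (f x) (f y) \<le> \<rho> * dist x y" "bounded A" "0 \<le> \<rho>"
  shows "diameter (f ` A) \<le> \<rho> * diameter A"
proof (cases "A = {}")
  case False
  then have "dist (f x) (f y) \<le> \<rho> * diameter A" if "x \<in> A" "y \<in> A" for x y
    using assms that by (meson diameter_bounded_bound mult_left_mono order_trans)
  then show ?thesis
    unfolding diameter_def[of "f ` A"] using False by (auto intro!: cSUP_least)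
qed (simp add: diameter_def)

lemma bounded_lipschitz_image:
  fixes f :: "'a::metric_space \<Rightarrow> 'b::metric_space"
  assumes f: "\<And>x y. dist (f x) (f y) \<le> \<rho> * dist x y" and "bounded A" "0 \<le> \<rho>"
  shows "bounded (f ` A)"
proof -
  obtain x e where "\<And>y. y \<in> A \<Longrightarrow> dist x y \<le> e"
    using \<open>bounded A\<close> unfolding bounded_def by blast
  then have "dist (f x) (f y) \<le> \<rho> * e" if "y \<in> A" for y
    using f[of x y] that \<open>0 \<le> \<rho>\<close> by (meson mult_left_mono order_trans)
  then show ?thesis unfolding bounded_def by blast
qed

lemma finite_cover_sum_lipschitz_image:
  fixes f :: "'a::metric_space \<Rightarrow> 'b::metric_space"
  assumes f: "\<And>x y. dist (f x) (f y) \<le> \<rho> * dist x y"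
    and "0 \<le> \<rho>" "0 \<le> t" and A: "finite_cover_sum t \<epsilon> A"
  shows "finite_cover_sum t (\<rho> powr t * \<epsilon>) (f ` A)"
proof -
  obtain Us where Us: "A \<subseteq> \<Union>(set Us)" "\<And>U. U \<in> set Us \<Longrightarrow> bounded U"
      "(\<Sum>U\<leftarrow>Us. diameter U powr t) \<le> \<epsilon>"
    using A unfolding finite_cover_sum_def by blast
  have bdd: "bounded (f ` U)" if "U \<in> set Us" for U
    by (rule bounded_lipschitz_image[OF f Us(2)[OF that] \<open>0 \<le> \<rho>\<close>])
  have "(\<Sum>U\<leftarrow>map ((`) f) Us. diameter U powr t) \<le> (\<Sum>U\<leftarrow>Us. \<rho> powr t * diameter U powr t)"
    unfolding map_map o_def
  proof (rule sum_list_mono)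
    fix U assume U: "U \<in> set Us"
    have "diameter (f ` U) powr t \<le> (\<rho> * diameter U) powr t"
    proof (rule powr_mono2)
      show "diameter (f ` U) \<le> \<rho> * diameter U"
        by (rule diameter_lipschitz_image_le[OF f Us(2)[OF U] \<open>0 \<le> \<rho>\<close>])
      show "0 \<le> diameter (f ` U)"
        by (rule diameter_ge_0[OF bdd[OF U]])
    qed (rule \<open>0 \<le> t\<close>)
    then show "diameter (f ` U) powr t \<le> \<rho> powr t * diameter U powr t"
      using \<open>0 \<le> \<rho>\<close> Us(2)[OF U] by (simp add: powr_mult diameter_ge_0)
  qed
  also have "\<dots> \<le> \<rho> powr t * \<epsilon>"
    unfolding sum_list_const_mult using Us(3) by (intro mult_left_mono) auto
  finally show ?thesis
    unfolding finite_cover_sum_def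
    using Us(1) bdd by (intro exI[of _ "map ((`) f) Us"]) (simp, blast)
qed

section \<open>Hausdorff dimension bounds from finite covers\<close>

text \<open>Each \<open>diameter U powr t\<close> is at most the whole sum, so
  \<open>\<epsilon> \<le> \<delta> powr t\<close> makes every covering set admissible at scale
  \<open>\<delta>\<close>. The list is padded with empty sets, which contribute 0.\<close>

lemma hausdorff_premeasure_le:
  assumes "0 < t" "0 < \<delta>" "\<epsilon> \<le> \<delta> powr t" and A: "finite_cover_sum t \<epsilon> A"
  shows "hausdorff_premeasure t \<delta> A \<le> ennreal \<epsilon>"
proof -
  obtain Us where Us: "A \<subseteq> \<Union>(set Us)" "\<And>U. U \<in> set Us \<Longrightarrow> bounded U"
      "(\<Sum>U\<leftarrow>Us. diameter U powr t) \<le> \<epsilon>"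
    using A unfolding finite_cover_sum_def by blast
  define V where "V n = (if n < length Us then Us ! n else {})" for n
  have small: "diameter U \<le> \<delta>" if "U \<in> set Us" for U
  proof (rule ccontr)
    assume "\<not> diameter U \<le> \<delta>"
    then have "\<delta> powr t < diameter U powr t"
      using assms by (intro powr_less_mono2) auto
    also have "\<dots> \<le> (\<Sum>U\<leftarrow>Us. diameter U powr t)"
      using that by (intro member_le_sum_list) auto
    finally show False using Us(3) assms(3) by simp
  qed
  have "delta_cover \<delta> A V"
    unfolding delta_cover_def
  proof (intro conjI allI)
    show "A \<subseteq> (\<Union>n. V n)"
    proof
      fix x assume "x \<in> A"
      then obtain n where "n < length Us" "x \<in> Us ! n"
        using Us(1) by (metis UnionE in_set_conv_nth subsetD)
      then show "x \<in> (\<Union>n. V n)" by (auto simp: V_def)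
    qed
  qed (use Us(2) small \<open>0 < \<delta>\<close> in \<open>auto simp: V_def diameter_empty\<close>)
  then have "hausdorff_premeasure t \<delta> A \<le> (\<Sum>n. ennreal (diameter_pow t (V n)))"
    unfolding hausdorff_premeasure_def by (intro INF_lower) simp
  also have "\<dots> = (\<Sum>n<length Us. ennreal (diameter_pow t (V n)))"
    by (rule suminf_finite) (auto simp: V_def diameter_pow_def)
  also have "\<dots> = (\<Sum>n<length Us. ennreal (diameter (Us ! n) powr t))"
    using \<open>0 < t\<close> by (intro sum.cong) (auto simp: V_def diameter_pow_def diameter_empty)
  also have "\<dots> = ennreal (\<Sum>U\<leftarrow>Us. diameter U powr t)"
    by (simp add: sum_list_sum_nth atLeast0LessThan)
  also have "\<dots> \<le> ennreal \<epsilon>"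
    using Us(3) by (rule ennreal_leI)
  finally show ?thesis .
qed

lemma hausdorff_dim_le:
  assumes "0 < t" and A: "\<And>\<epsilon>. 0 < \<epsilon> \<Longrightarrow> finite_cover_sum t \<epsilon> A"
  shows "hausdorff_dim A \<le> ereal t"
proof -
  have "hausdorff_premeasure t \<delta> A = 0" if "0 < \<delta>" for \<delta>
  proof -
    have "hausdorff_premeasure t \<delta> A \<le> 0 + ennreal \<epsilon>" if "0 < \<epsilon>" for \<epsilon>
    proof -
      \<comment> \<open>The minimum with \<open>\<delta> powr t\<close> makes the cover fine enough
        for scale \<open>\<delta>\<close>.\<close>
      have "hausdorff_premeasure t \<delta> A \<le> ennreal (min \<epsilon> (\<delta> powr t))"
        using \<open>0 < t\<close> \<open>0 < \<delta>\<close> \<open>0 < \<epsilon>\<close> by (intro hausdorff_premeasure_le A) auto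
      also have "\<dots> \<le> ennreal \<epsilon>" by (intro ennreal_leI) simp
      finally show ?thesis by simp
    qed
    then have "hausdorff_premeasure t \<delta> A \<le> 0"
      by (rule ennreal_le_epsilon)
    then show ?thesis by simp
  qed
  then have "hausdorff_measure t A = 0"
    unfolding hausdorff_measure_def by (simp add: SUP_eq_const)
  then show ?thesis
    unfolding hausdorff_dim_def using \<open>0 < t\<close> by (intro Inf_lower) auto
qed

text \<open>Each \<open>A g\<close> first covers itself. Every use of the inclusions multiplies the
  cover sums by at most \<open>c\<close>, the largest of the finitely many sums of ratios. As
  \<open>c < 1\<close>, iteration makes them arbitrarily small.\<close>

lemma hausdorff_dim_graph_directed_le:
  fixes A :: "'g \<Rightarrow> 'a::metric_space set"
  assumes fin: "finite G" and "g \<in> G" and J: "\<And>g. g \<in> G \<Longrightarrow> finite (J g)"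
    and bdd: "\<And>g. g \<in> G \<Longrightarrow> bounded (A g)"
    and cover: "\<And>g. g \<in> G \<Longrightarrow> A g \<subseteq> (\<Union>u\<in>J g. f g u ` A (\<tau> g u))"
    and \<tau>: "\<And>g u. g \<in> G \<Longrightarrow> u \<in> J g \<Longrightarrow> \<tau> g u \<in> G"
    and \<rho>: "\<And>g u. g \<in> G \<Longrightarrow> u \<in> J g \<Longrightarrow> 0 \<le> \<rho> g u"
    and lip: "\<And>g u x y. g \<in> G \<Longrightarrow> u \<in> J g \<Longrightarrow> dist (f g u x) (f g u y) \<le> \<rho> g u * dist x y"
    and "0 < t" and less1: "\<And>g. g \<in> G \<Longrightarrow> (\<Sum>u\<in>J g. \<rho> g u powr t) < 1"
  shows "hausdorff_dim (A g) \<le> ereal t"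
proof -
  define c where "c = Max ((\<lambda>g. \<Sum>u\<in>J g. \<rho> g u powr t) ` G)"
  define D where "D = Max ((\<lambda>g. diameter (A g) powr t) ` G)"
  have c: "(\<Sum>u\<in>J g. \<rho> g u powr t) \<le> c" if "g \<in> G" for g
    unfolding c_def using fin that by (intro Max_ge) auto
  have "c < 1"
    unfolding c_def using fin \<open>g \<in> G\<close> less1 by (subst Max_less_iff) auto
  have "0 \<le> c"
    using c[OF \<open>g \<in> G\<close>] by (rule order_trans[rotated]) (simp add: sum_nonneg)
  have D: "diameter (A g) powr t \<le> D" if "g \<in> G" for g
    unfolding D_def using fin that by (intro Max_ge) auto
  have "0 \<le> D"
    using D[OF \<open>g \<in> G\<close>] by (rule order_trans[rotated]) simp
  have main: "finite_cover_sum t (c ^ n * D) (A g)" if "g \<in> G" for n g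
    using that
  proof (induction n arbitrary: g)
    case 0
    then show ?case
      using finite_cover_sum_mono[OF finite_cover_sum_self[OF bdd] order_refl D] by simp
  next
    case (Suc n)
    have "finite_cover_sum t (\<Sum>u\<in>J g. \<rho> g u powr t * (c ^ n * D)) (\<Union>u\<in>J g. f g u ` A (\<tau> g u))"
      using Suc \<open>0 < t\<close> lip \<rho> \<tau> J
      by (intro finite_cover_sum_UN finite_cover_sum_lipschitz_image) auto
    moreover have "(\<Sum>u\<in>J g. \<rho> g u powr t * (c ^ n * D)) \<le> c * (c ^ n * D)"
      unfolding sum_distrib_right[symmetric]
      using c Suc.prems \<open>0 \<le> c\<close> \<open>0 \<le> D\<close> by (intro mult_right_mono) auto
    ultimately show ?case
      using finite_cover_sum_mono cover[OF Suc.prems] by (simp add: mult.assoc)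
  qed
  have lim: "(\<lambda>n. c ^ n * D) \<longlonglongrightarrow> 0"
    using \<open>0 \<le> c\<close> \<open>c < 1\<close> by (intro tendsto_mult_left_zero LIMSEQ_realpow_zero)
  show ?thesis
  proof (rule hausdorff_dim_le[OF \<open>0 < t\<close>])
    fix \<epsilon> :: real assume "0 < \<epsilon>"
    then obtain n where "c ^ n * D < \<epsilon>"
      using order_tendstoD(2)[OF lim] by (force simp: eventually_sequentially)
    then show "finite_cover_sum t \<epsilon> (A g)"
      by (intro finite_cover_sum_mono[OF main[OF \<open>g \<in> G\<close>, of n]]) auto
  qed
qed

section \<open>Orthogonal projections\<close>

lemma orthogonal_projection_eqI:
  fixes M :: "'a::euclidean_space set"
  assumes "subspace M" "y \<in> M" "\<And>w. w \<in> M \<Longrightarrow> orthogonal (x - y) w"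
  shows "orthogonal_projection M x = y"
  unfolding orthogonal_projection_def
  using orthogonal_projection_ex1[OF assms(1), of x] assms(2,3) by (intro the1_equality) auto

lemma orthogonal_projection_in_orthogonal:
  fixes M :: "'a::euclidean_space set"
  assumes "subspace M"
  shows "orthogonal_projection M x \<in> M"
    and "w \<in> M \<Longrightarrow> orthogonal (x - orthogonal_projection M x) w"
  using theI'[OF orthogonal_projection_ex1[OF assms, of x]]
  unfolding orthogonal_projection_def by auto

lemma linear_orthogonal_projection:
  fixes M :: "'a::euclidean_space set"
  assumes "subspace M"
  shows "linear (orthogonal_projection M)"
proof (rule linearI)
  note P = orthogonal_projection_in_orthogonal[OF assms]
  fix x y :: 'a and c :: real
  show "orthogonal_projection M (x + y) = orthogonal_projection M x + orthogonal_projection M y"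
  proof (rule orthogonal_projection_eqI[OF assms])
    show "orthogonal (x + y - (orthogonal_projection M x + orthogonal_projection M y)) w"
      if "w \<in> M" for w
      using P(2)[OF that, of x] P(2)[OF that, of y] by (simp add: orthogonal_def algebra_simps)
  qed (use P(1) assms in \<open>simp add: subspace_add\<close>)
  show "orthogonal_projection M (c *\<^sub>R x) = c *\<^sub>R orthogonal_projection M x"
  proof (rule orthogonal_projection_eqI[OF assms])
    show "orthogonal (c *\<^sub>R x - c *\<^sub>R orthogonal_projection M x) w" if "w \<in> M" for w
      using P(2)[OF that, of x] by (simp add: orthogonal_def algebra_simps)
  qed (use P(1) assms in \<open>simp add: subspace_scale\<close>)
qed

text \<open>The orthogonal complement of \<open>w\<close> is a hyperplane, or the whole space if
  \<open>w = 0\<close>; either way its dimension is at least \<open>l\<close>.\<close>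

lemma subspace_of_dim_orthogonal_to:
  fixes w :: "'a::euclidean_space"
  assumes "l < DIM('a)"
  obtains M where "subspace M" "dim M = l" "\<And>x. x \<in> M \<Longrightarrow> orthogonal w x"
proof -
  have "l \<le> dim {x. w \<bullet> x = 0}"
    using assms by (cases "w = 0") (auto simp: dim_hyperplane)
  then obtain M where M: "subspace M" "M \<subseteq> span {x. w \<bullet> x = 0}" "dim M = l"
    using choose_subspace_of_subspace by blast
  moreover have "span {x. w \<bullet> x = 0} = {x. w \<bullet> x = 0}"
    using subspace_hyperplane by (simp add: span_eq_iff)
  ultimately show ?thesis by (intro that) (auto simp: orthogonal_def)
qed

section \<open>Words\<close>

text \<open>The first letter acts last. One definition serves both \<open>S\<close> and
  \<open>T\<close>, so that \<open>word_map T u\<close> is the linear part of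
  \<open>word_map S u\<close>.\<close>

definition word_map :: "(nat \<Rightarrow> 'a \<Rightarrow> 'a) \<Rightarrow> nat list \<Rightarrow> 'a \<Rightarrow> 'a" where
  "word_map F u = foldr (\<circ>) (map F u) id"

abbreviation word_ratio :: "(nat \<Rightarrow> real) \<Rightarrow> nat list \<Rightarrow> real" where
  "word_ratio r u \<equiv> prod_list (map r u)"

definition words :: "nat \<Rightarrow> nat \<Rightarrow> nat list set" where
  "words m L = {u. set u \<subseteq> {..<m} \<and> length u = L}"

lemma word_map_simps [simp]:
  "word_map F [] = id" "word_map F (i # u) = F i \<circ> word_map F u"
  by (simp_all add: word_map_def)

lemma word_map_append: "word_map F (u @ v) = word_map F u \<circ> word_map F v"
  by (induction u) (auto simp: o_assoc)

lemma word_map_concat_replicate: "word_map F (concat (replicate n u)) = word_map F u ^^ n"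
  by (induction n) (auto simp: word_map_append)

lemma finite_words: "finite (words m L)"
  unfolding words_def by (intro finite_lists_length_eq) simp

lemma words_0: "words m 0 = {[]}"
  by (auto simp: words_def)

lemma words_Suc: "words m (Suc L) = (\<lambda>(u, i). i # u) ` (words m L \<times> {..<m})"
  unfolding words_def by (rule lists_length_Suc_eq)

text \<open>Ratios multiply along words, so expanding the \<open>L\<close>-th power by
  distributivity yields one term per word of length \<open>L\<close>.\<close>

lemma sum_word_ratio_powr:
  assumes "\<And>i. i < m \<Longrightarrow> 0 < r i"
  shows "(\<Sum>u\<in>words m L. word_ratio r u powr t) = (\<Sum>i<m. r i powr t) ^ L"
proof (induction L)
  case 0
  then show ?case by (simp add: words_0)
next
  case (Suc L)
  have nonneg: "0 \<le> word_ratio r u" if "u \<in> words m L" for u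
    using that assms unfolding words_def by (intro prod_list_nonneg) (auto intro: less_imp_le)
  have "(\<Sum>u\<in>words m (Suc L). word_ratio r u powr t)
      = (\<Sum>(u, i)\<in>words m L \<times> {..<m}. word_ratio r (i # u) powr t)"
    unfolding words_Suc by (subst sum.reindex) (auto simp: inj_on_def intro!: sum.cong)
  also have "\<dots> = (\<Sum>(u, i)\<in>words m L \<times> {..<m}. word_ratio r u powr t * r i powr t)"
    using nonneg assms by (intro sum.cong) (auto simp: powr_mult mult.commute less_imp_le)
  also have "\<dots> = (\<Sum>u\<in>words m L. word_ratio r u powr t) * (\<Sum>i<m. r i powr t)"
    by (simp add: sum_product sum.cartesian_product)
  finally show ?case using Suc by simp
qed

lemma attractor_words:
  assumes "K = (\<Union>i<m. S i ` K)"
  shows "K = (\<Union>u\<in>words m L. word_map S u ` K)"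
proof (induction L)
  case 0
  then show ?case by (simp add: words_0)
next
  case (Suc L)
  have "(\<Union>u\<in>words m (Suc L). word_map S u ` K)
      = (\<Union>i<m. S i ` (\<Union>u\<in>words m L. word_map S u ` K))"
    by (auto simp: words_Suc image_iff) blast+
  then show ?case using Suc assms by simp
qed

section \<open>Words of a self-similar iterated function system\<close>

lemma orthogonal_transformation_word_map:
  assumes "ss_ifs m S r T v" "set u \<subseteq> {..<m}"
  shows "orthogonal_transformation (word_map T u)"
  using assms(2)
proof (induction u)
  case Nil
  then show ?case by (simp add: id_def)
next
  case (Cons i u)
  then show ?case
    using assms(1) by (auto simp del: o_apply simp: ss_ifs_def intro!: orthogonal_transformation_compose)
qed

lemma word_ratio_pos:
  assumes "ss_ifs m S r T v" "set u \<subseteq> {..<m}"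
  shows "0 < word_ratio r u"
  using assms(2)
proof (induction u)
  case (Cons i u)
  then show ?case using assms(1) by (auto simp: ss_ifs_def)
qed simp

text \<open>By linearity of each \<open>T i\<close> the translations collect into one constant,
  which is the value at 0.\<close>

lemma word_map_affine:
  assumes "ss_ifs m S r T v" "set u \<subseteq> {..<m}"
  shows "word_map S u x = word_ratio r u *\<^sub>R word_map T u x + word_map S u 0"
  using assms(2)
proof (induction u)
  case (Cons i u)
  then have i: "i < m" and u: "set u \<subseteq> {..<m}" by auto
  have S: "S i x = r i *\<^sub>R T i x + v i" for x
    using assms(1) i by (simp add: ss_ifs_def)
  have "linear (T i)"
    using assms(1) i by (simp add: ss_ifs_def orthogonal_transformation_linear)
  then show ?case
    by (simp add: S Cons.IH[OF u] linear_add linear_scale algebra_simps)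
qed simp

lemma word_map_in_transformation_group:
  assumes "ss_ifs m S r T v" "set u \<subseteq> {..<m}"
  shows "word_map T u \<in> transformation_group m T"
  using assms(2)
proof (induction u)
  case Nil
  have "\<one>\<^bsub>BijGroup UNIV\<^esub> \<in> transformation_group m T"
    unfolding transformation_group_def by (rule generate.one)
  then show ?case by (simp add: BijGroup_def id_def restrict_def)
next
  case (Cons i u)
  then have i: "i < m" and u: "set u \<subseteq> {..<m}" by auto
  have "T i \<otimes>\<^bsub>BijGroup UNIV\<^esub> word_map T u \<in> transformation_group m T"
    using Cons.IH[OF u] i unfolding transformation_group_def
    by (intro generate.eng[OF generate.incl]) auto
  \<comment> \<open>The product of \<open>BijGroup UNIV\<close> is composition only on its carrier,
    so both factors must be shown to lie there.\<close>
  moreover have "T i \<in> carrier (BijGroup UNIV)"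
    using assms(1) i by (auto simp: ss_ifs_def intro: orthogonal_transformation_in_BijGroup)
  moreover have "word_map T u \<in> carrier (BijGroup UNIV)"
    by (intro orthogonal_transformation_in_BijGroup
        orthogonal_transformation_word_map[OF assms(1) u])
  ultimately show ?case
    by (simp add: BijGroup_def compose_def restrict_def o_def)
qed

section \<open>Powers of words when the transformation group is finite\<close>

text \<open>Pigeonhole: two different exponents give the same power, and injectivity cancels the
  smaller one.\<close>

lemma inj_funpow_eq_id:
  assumes "inj f" "finite (range (\<lambda>n. f ^^ n))"
  obtains n where "0 < n" "f ^^ n = id"
proof -
  have "\<not> inj (\<lambda>n. f ^^ n)"
    using assms(2) finite_imageD by blast
  then obtain a b where "a < b" and ab: "f ^^ a = f ^^ b"
    by (metis injI nat_neq_iff)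
  have "(f ^^ (b - a)) x = x" for x
  proof -
    have "(f ^^ a) ((f ^^ (b - a)) x) = (f ^^ (a + (b - a))) x"
      by (simp add: funpow_add)
    also have "\<dots> = (f ^^ a) x" using \<open>a < b\<close> ab by simp
    finally have "(f ^^ a) ((f ^^ (b - a)) x) = (f ^^ a) x" .
    then show ?thesis
      using inj_fn[OF assms(1), of a] by (simp add: inj_eq)
  qed
  then show ?thesis
    using \<open>a < b\<close> by (intro that[of "b - a"]) auto
qed

text \<open>All powers of the linear part of \<open>u\<close> lie in the finite group, so some
  repetition of \<open>u\<close> gives a map without rotation.\<close>

lemma word_power_trivial:
  assumes ifs: "ss_ifs m S r T v" and "finite (transformation_group m T)" and u: "set u \<subseteq> {..<m}"
  obtains n where "0 < n" "word_map T (concat (replicate n u)) = id"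
proof (rule inj_funpow_eq_id[of "word_map T u"])
  show "inj (word_map T u)"
    by (intro orthogonal_transformation_inj orthogonal_transformation_word_map[OF ifs u])
  have "word_map T u ^^ n \<in> transformation_group m T" for n
    unfolding word_map_concat_replicate[symmetric]
    by (rule word_map_in_transformation_group[OF ifs]) (use u in auto)
  then show "finite (range (\<lambda>n. word_map T u ^^ n))"
    by (intro finite_subset[OF _ assms(2)]) auto
qed (use that in \<open>auto simp: word_map_concat_replicate\<close>)

section \<open>Number of maps and choice of the exponent\<close>

text \<open>A single contraction would map \<open>K\<close> onto itself while strictly shrinking its
  positive diameter.\<close>

lemma ss_ifs_two_maps:
  assumes ifs: "ss_ifs m S r T v" and K: "is_attractor m S K"
    and xy: "x \<in> K" "y \<in> K" "x \<noteq> y"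
  shows "2 \<le> m"
proof (rule ccontr)
  assume "\<not> 2 \<le> m"
  moreover have "m \<noteq> 0" using K by (auto simp: is_attractor_def)
  ultimately have [simp]: "m = 1" by simp
  have "bounded K" using K by (simp add: is_attractor_def compact_imp_bounded)
  have "dist (S 0 x) (S 0 y) \<le> r 0 * dist x y" for x y
    using ifs by (simp add: ss_ifs_def dist_norm orthogonal_transformation
        flip: scaleR_right_diff_distrib linear_diff)
  then have "diameter (S 0 ` K) \<le> r 0 * diameter K"
    using ifs \<open>bounded K\<close> by (intro diameter_lipschitz_image_le) (auto simp: ss_ifs_def)
  moreover have "S 0 ` K = K" using K by (auto simp: is_attractor_def lessThan_Suc)
  moreover have "0 < diameter K"
    using diameter_bounded_bound[OF \<open>bounded K\<close> xy(1,2)] xy(3) by (smt (verit) zero_less_dist_iff)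
  moreover have "r 0 < 1" using ifs by (simp add: ss_ifs_def)
  ultimately show False by simp
qed

text \<open>For \<open>s \<le> 0\<close> each of the at least two terms would be at least 1.
  Positivity leaves room for an exponent strictly between 0 and \<open>s\<close>.\<close>

lemma similarity_dim_pos:
  assumes "ss_ifs m S r T v" "is_similarity_dim m r s" "2 \<le> m"
  shows "0 < s"
proof (rule ccontr)
  assume "\<not> 0 < s"
  then have "1 \<le> r i powr s" if "i < m" for i
    using assms(1) that powr_mono'[of s 0 "r i"] by (auto simp: ss_ifs_def)
  then have "(\<Sum>i<m. 1) \<le> (\<Sum>i<m. r i powr s)"
    by (intro sum_mono) auto
  then show False using assms(2,3) by (simp add: is_similarity_dim_def)
qed

text \<open>For positive ratios the sums are continuous in the exponent, so finitely many strict
  inequalities at \<open>s\<close> persist just to its left.\<close>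

lemma exponent_below:
  fixes \<rho> :: "'u \<Rightarrow> real" and s :: real
  assumes "finite G" "0 < s"
    and pos: "\<And>g u. g \<in> G \<Longrightarrow> u \<in> J g \<Longrightarrow> 0 < \<rho> u"
    and less1: "\<And>g. g \<in> G \<Longrightarrow> (\<Sum>u\<in>J g. \<rho> u powr s) < 1"
  obtains t where "0 < t" "t < s" "\<And>g. g \<in> G \<Longrightarrow> (\<Sum>u\<in>J g. \<rho> u powr t) < 1"
proof -
  have "\<forall>\<^sub>F t in at_left s. (\<Sum>u\<in>J g. \<rho> u powr t) < 1" if "g \<in> G" for g
  proof (rule order_tendstoD(2)[OF _ less1[OF that]])
    show "((\<lambda>t. \<Sum>u\<in>J g. \<rho> u powr t) \<longlongrightarrow> (\<Sum>u\<in>J g. \<rho> u powr s)) (at_left s)"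
      using pos[OF that] by (intro tendsto_intros) force
  qed
  then have "\<forall>\<^sub>F t in at_left s. \<forall>g\<in>G. (\<Sum>u\<in>J g. \<rho> u powr t) < 1"
    using \<open>finite G\<close> by (intro eventually_ball_finite) auto
  moreover have "\<forall>\<^sub>F t in at_left s. t \<in> {0<..<s}"
    using \<open>0 < s\<close> by (rule eventually_at_left_real)
  ultimately have "\<forall>\<^sub>F t in at_left s. t \<in> {0<..<s} \<and> (\<forall>g\<in>G. (\<Sum>u\<in>J g. \<rho> u powr t) < 1)"
    by eventually_elim simp
  then obtain t where "t \<in> {0<..<s} \<and> (\<forall>g\<in>G. (\<Sum>u\<in>J g. \<rho> u powr t) < 1)"
    using eventually_happens'[OF trivial_limit_at_left_real] by blast
  then show ?thesis by (intro that) auto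
qed

section \<open>Words with prescribed linear part\<close>

text \<open>Suitable positive powers of the letters 0 and 1 work: the two concatenations begin with
  different letters.\<close>

lemma noncommuting_trivial_words:
  assumes ifs: "ss_ifs m S r T v" and "finite (transformation_group m T)" and "2 \<le> m"
  obtains a b where "set a \<subseteq> {..<m}" "set b \<subseteq> {..<m}" "a @ b \<noteq> b @ a"
    "word_map T a = id" "word_map T b = id"
proof -
  obtain k where k: "0 < k" "word_map T (concat (replicate k [0])) = id"
    using word_power_trivial[OF assms(1,2), of "[0]"] \<open>2 \<le> m\<close> by auto
  obtain n where n: "0 < n" "word_map T (concat (replicate n [1])) = id"
    using word_power_trivial[OF assms(1,2), of "[1]"] \<open>2 \<le> m\<close> by auto
  show ?thesis
  proof (rule that[OF _ _ _ k(2) n(2)])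
    show "concat (replicate k [0::nat]) @ concat (replicate n [1])
        \<noteq> concat (replicate n [1]) @ concat (replicate k [0])"
      using k(1) n(1) by (cases k; cases n) auto
  qed (use \<open>2 \<le> m\<close> in auto)
qed

text \<open>If the \<open>n\<close>-th power of the linear part is the identity, then its power
  \<open>n - 1\<close> is an inverse, and it again belongs to a word.\<close>

lemma word_map_inverse:
  assumes ifs: "ss_ifs m S r T v" and "finite (transformation_group m T)" and u: "set u \<subseteq> {..<m}"
  obtains u' where "set u' \<subseteq> {..<m}" "word_map T u \<circ> word_map T u' = id"
proof -
  obtain n where n: "0 < n" "word_map T (concat (replicate n u)) = id"
    using word_power_trivial[OF assms] .
  show ?thesis
  proof (rule that)
    show "set (concat (replicate (n - 1) u)) \<subseteq> {..<m}" using u by auto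
    show "word_map T u \<circ> word_map T (concat (replicate (n - 1) u)) = id"
      using n by (cases n) (auto simp: word_map_append)
  qed
qed

section \<open>The dimension drop of the projection\<close>

lemma hausdorff_dim_projection_less:
  fixes S :: "nat \<Rightarrow> 'a::euclidean_space \<Rightarrow> 'a"
  assumes ifs: "ss_ifs m S r T v" and K: "is_attractor m S K" and s: "is_similarity_dim m r s"
    and fin: "finite (transformation_group m T)" and m: "2 \<le> m"
    and a: "set a \<subseteq> {..<m}" "word_map T a = id" and b: "set b \<subseteq> {..<m}" "word_map T b = id"
    and ab: "a @ b \<noteq> b @ a"
    and M: "subspace M" "\<And>x. x \<in> M \<Longrightarrow> orthogonal (word_map S (a @ b) 0 - word_map S (b @ a) 0) x"
  shows "hausdorff_dim (orthogonal_projection M ` K) < ereal s"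
proof -
  define P where "P = orthogonal_projection M"
  have P: "linear P"
    unfolding P_def by (rule linear_orthogonal_projection[OF M(1)])
  define w where "w = word_map S (a @ b) 0 - word_map S (b @ a) 0"
  have Pw: "P w = 0"
    unfolding P_def w_def
    using M by (intro orthogonal_projection_eqI) (auto simp: subspace_0)
  \<comment> \<open>The vertices of the graph-directed system: \<open>g\<close> stands for the set
    \<open>P\<close> g \<open>K\<close>. The empty word provides the vertex \<open>id\<close>, which
    belongs to the projection of \<open>K\<close> itself.\<close>
  define G where "G = word_map T ` {u. set u \<subseteq> {..<m}}"
  have "finite G"
    using word_map_in_transformation_group[OF ifs]
    by (intro finite_subset[OF _ fin]) (auto simp: G_def)
  have "\<exists>u'. set u' \<subseteq> {..<m} \<and> g \<circ> word_map T u' = id" if g: "g \<in> G" for g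
  proof -
    obtain u where u: "g = word_map T u" "set u \<subseteq> {..<m}"
      using g unfolding G_def by blast
    obtain u' where "set u' \<subseteq> {..<m}" "word_map T u \<circ> word_map T u' = id"
      by (rule word_map_inverse[OF ifs fin u(2)])
    then show ?thesis
      unfolding u(1) by (intro exI conjI)
  qed
  then have "\<exists>U. \<forall>g\<in>G. set (U g) \<subseteq> {..<m} \<and> g \<circ> word_map T (U g) = id"
    by (intro bchoice ballI)
  then obtain U where U: "\<And>g. g \<in> G \<Longrightarrow> set (U g) \<subseteq> {..<m}"
      "\<And>g. g \<in> G \<Longrightarrow> g \<circ> word_map T (U g) = id"
    by blast
  have G: "linear g" if "g \<in> G" for g
    using that orthogonal_transformation_word_map[OF ifs]
    by (auto simp: G_def orthogonal_transformation_linear)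
  \<comment> \<open>\<open>p g\<close> and \<open>q g\<close> are different words of equal length
    and equal ratio; \<open>U g\<close> is prefixed so that \<open>g\<close> is undone before the
    two differing tails are compared. The word length in \<open>W g\<close> varies with
    \<open>g\<close>.\<close>
  define p where "p g = U g @ a @ b" for g
  define q where "q g = U g @ b @ a" for g
  define W where "W g = words m (length (q g))" for g
  define J where "J g = W g - {q g}" for g
  \<comment> \<open>Only a homothety remains as the map: the rotation of the word \<open>u\<close>
    is moved into the index, which changes from \<open>g\<close> to
    \<open>g \<circ> word_map T u\<close>.\<close>
  define f where "f g u y = word_ratio r u *\<^sub>R y + P (g (word_map S u 0))" for g u and y :: 'a
  have W: "set u \<subseteq> {..<m}" if "u \<in> W g" for u g
    using that by (simp add: W_def words_def)
  have W_pos: "0 < word_ratio r u" if "u \<in> W g" for u g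
    using word_ratio_pos[OF ifs W[OF that]] .
  have q_in: "q g \<in> W g" and p_in: "p g \<in> J g" if "g \<in> G" for g
    using U(1)[OF that] a(1) b(1) ab by (auto simp: J_def W_def words_def p_def q_def)
  have step: "P (g (word_map S u x)) = f g u (P (g (word_map T u x)))"
    if "g \<in> G" "set u \<subseteq> {..<m}" for g u x
    unfolding f_def word_map_affine[OF ifs that(2), of x]
    by (simp add: linear_add[OF G[OF that(1)]] linear_scale[OF G[OF that(1)]]
        linear_add[OF P] linear_scale[OF P])
  have same: "P (g (word_map S (q g) x)) = P (g (word_map S (p g) x))" if "g \<in> G" for g x
  proof -
    \<comment> \<open>Both maps have the identity as linear part and the same ratio, so they differ
      by the constant \<open>w\<close>.\<close>
    have "word_map S (a @ b) x = word_map S (b @ a) x + w"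
      using word_map_affine[OF ifs, of "a @ b" x] word_map_affine[OF ifs, of "b @ a" x] a b
      by (simp add: w_def word_map_append[of T] mult.commute)
    then have "word_map S (p g) x = word_map S (U g) (word_map S (b @ a) x + w)"
      unfolding p_def by (simp add: word_map_append)
    then have "P (g (word_map S (p g) x))
        = f g (U g) (P ((g \<circ> word_map T (U g)) (word_map S (b @ a) x + w)))"
      using step[OF that U(1)[OF that]] by simp
    \<comment> \<open>Since \<open>g \<circ> word_map T (U g) = id\<close>, the vector
      \<open>w\<close> reaches \<open>P\<close> unrotated and is annihilated.\<close>
    also have "\<dots> = f g (U g) (P ((g \<circ> word_map T (U g)) (word_map S (b @ a) x)))"
      using Pw by (simp add: U(2)[OF that] linear_add[OF P])
    also have "\<dots> = P (g (word_map S (q g) x))"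
      using step[OF that U(1)[OF that]] by (simp add: q_def word_map_append)
    finally show ?thesis by simp
  qed
  have cover: "P ` g ` K \<subseteq> (\<Union>u\<in>J g. f g u ` (P ` (g \<circ> word_map T u) ` K))" if g: "g \<in> G" for g
  proof
    fix y assume "y \<in> P ` g ` K"
    then obtain z where z: "z \<in> K" "y = P (g z)" by blast
    have "K = (\<Union>u\<in>W g. word_map S u ` K)"
      unfolding W_def using K by (intro attractor_words) (simp add: is_attractor_def)
    then obtain u x where u: "u \<in> W g" and x: "x \<in> K" "z = word_map S u x"
      using z(1) by blast
    \<comment> \<open>A point of the dropped piece \<open>q g\<close> has the same image as the
      point of the piece \<open>p g\<close> with the same parameter \<open>x\<close>.\<close>
    obtain u' where u': "u' \<in> J g" "y = P (g (word_map S u' x))"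
    proof (cases "u = q g")
      case True
      then show ?thesis using that[OF p_in[OF g]] z x same[OF g] by simp
    next
      case False
      then show ?thesis using that[of u] u z x by (simp add: J_def)
    qed
    then have "y = f g u' (P ((g \<circ> word_map T u') x))"
      using step[OF g, of u' x] W[of u' g] by (simp add: J_def)
    then show "y \<in> (\<Union>u\<in>J g. f g u ` (P ` (g \<circ> word_map T u) ` K))"
      using u' x by blast
  qed
  have "0 < s" using similarity_dim_pos[OF ifs s m] .
  have less1: "(\<Sum>u\<in>J g. word_ratio r u powr s) < 1" if "g \<in> G" for g
  proof -
    \<comment> \<open>Over all words of the given length the sum is exactly 1; removing
      \<open>q g\<close>, of positive ratio, makes it strictly smaller.\<close>
    have "(\<Sum>u\<in>W g. word_ratio r u powr s) = 1"
      unfolding W_def using ifs s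
      by (subst sum_word_ratio_powr) (auto simp: ss_ifs_def is_similarity_dim_def)
    then show ?thesis
      unfolding J_def using q_in[OF that] W_pos[OF q_in[OF that]]
      by (subst sum_diff1) (auto simp: W_def finite_words)
  qed
  obtain t where t: "0 < t" "t < s" "\<And>g. g \<in> G \<Longrightarrow> (\<Sum>u\<in>J g. word_ratio r u powr t) < 1"
    using exponent_below[OF \<open>finite G\<close> \<open>0 < s\<close>, of J "word_ratio r"] W_pos less1
    unfolding J_def by blast
  have "id \<in> G"
    unfolding G_def by (rule image_eqI[of _ _ "[]"]) auto
  have "hausdorff_dim (P ` id ` K) \<le> ereal t"
  proof (rule hausdorff_dim_graph_directed_le[where A = "\<lambda>g. P ` g ` K" and f = f and J = J and G = G
        and \<tau> = "\<lambda>g u. g \<circ> word_map T u" and \<rho> = "\<lambda>g u. word_ratio r u"])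
    show "bounded (P ` g ` K)" if "g \<in> G" for g
      using K P G[OF that]
      by (intro bounded_linear_image compact_imp_bounded)
        (auto simp: is_attractor_def linear_conv_bounded_linear)
    show "g \<circ> word_map T u \<in> G" if g: "g \<in> G" and u: "u \<in> J g" for g u
    \<comment> \<open>Linear parts of words are closed under composition, by concatenation of the
      words.\<close>
    proof -
      obtain u0 where "g = word_map T u0" "set u0 \<subseteq> {..<m}"
        using g unfolding G_def by blast
      then show ?thesis
        unfolding G_def using u W[of u g]
        by (intro image_eqI[of _ _ "u0 @ u"]) (auto simp: word_map_append J_def)
    qed
    show "dist (f g u x) (f g u y) \<le> word_ratio r u * dist x y" if "u \<in> J g" for g u x y
      using W_pos[of u g] that
      by (simp add: f_def J_def dist_norm flip: scaleR_right_diff_distrib)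
    show "finite (J g)" for g
      by (simp add: J_def W_def finite_words)
    show "0 \<le> word_ratio r u" if "u \<in> J g" for g u
      using W_pos[of u g] that by (simp add: J_def)
  qed (use \<open>finite G\<close> \<open>id \<in> G\<close> cover t in blast)+
  then show ?thesis
    using t(2) unfolding P_def by (simp add: le_less_trans)
qed

theorem theorem1p2:
  fixes S :: "nat \<Rightarrow> real ^ 'n \<Rightarrow> real ^ 'n"
    and r :: "nat \<Rightarrow> real"
    and T :: "nat \<Rightarrow> real ^ 'n \<Rightarrow> real ^ 'n"
    and v :: "nat \<Rightarrow> real ^ 'n"
    and K :: "(real ^ 'n) set"
    and s :: real
    and m l :: nat
  assumes "ss_ifs m S r T v"
    and "is_attractor m S K"
    and "\<exists>x\<in>K. \<exists>y\<in>K. x \<noteq> y"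
    and "is_similarity_dim m r s"
    and "finite (transformation_group m T)"
    and "l < CARD('n)"
  shows "\<exists>M :: (real ^ 'n) set. subspace M \<and> dim M = l \<and>
           hausdorff_dim (orthogonal_projection M ` K) < ereal s"
proof -
  have m: "2 \<le> m"
    using assms(3) by (auto intro: ss_ifs_two_maps[OF assms(1,2)])
  obtain a b where ab: "set a \<subseteq> {..<m}" "set b \<subseteq> {..<m}" "a @ b \<noteq> b @ a"
      "word_map T a = id" "word_map T b = id"
    using noncommuting_trivial_words[OF assms(1,5) m] .
  obtain M where M: "subspace M" "dim M = l"
      "\<And>x. x \<in> M \<Longrightarrow> orthogonal (word_map S (a @ b) 0 - word_map S (b @ a) 0) x"
    using subspace_of_dim_orthogonal_to[of l "word_map S (a @ b) 0 - word_map S (b @ a) 0"] assms(6)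
    by auto
  have "hausdorff_dim (orthogonal_projection M ` K) < ereal s"
    using hausdorff_dim_projection_less[OF assms(1,2,4,5) m ab(1,4,2,5,3) M(1,3)] .
  with M show ?thesis by blast
qed

end
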